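(* Let $n\ge 1$, let $\lambda$ be a partition of $n$, identified with its Young diagram, and let $P$ be any standard Young tableau of shape $\lambda$. Let $$\pi_\lambda(x)=\sum_{Q\in\mathfrak{st}_\lambda}x^{|q_{P,Q}|},$$ where $\mathfrak{st}_\lambda$ is the set of standard Young tableaux of shape $\lambda$, $q_{P,Q}$ is the $P$-pedestal of $Q$ and $|q_{P,Q}|=\sum_{\alpha\in\lambda}q_{P,Q}(\alpha)$. (Thus $\pi_\lambda(x)$ is the principal specialization $x_i\mapsto x^i$ of the polynomial $\sum_{Q\in\mathfrak{st}_\lambda}\prod_{\alpha\in\lambda}x_{q_{P,Q}(\alpha)}$.) Then, as formal power series in $x$, $$\frac{1}{\prod_{\alpha\in\lambda}(1-x^{h_\alpha})}=\frac{\pi_\lambda(x)}{(1-x)(1-x^2)\cdots(1-x^n)},$$ where $h_\alpha$ is the hook length of the node $\alpha$ of $\lambda$.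
   Context: A partition $\lambda=(\lambda_1\ge\dots\ge\lambda_l>0)$ of $n$ is identified with the set of nodes $(i,j)$ with $1\le i\le l$, $1\le j\le\lambda_i$. The hook length $h_\alpha$ of a node $\alpha=(i,j)\in\lambda$ is the number of nodes $(i',j')\in\lambda$ with either $i'=i,\ j'\ge j$ or $j'=j,\ i'>i$. A standard Young tableau of shape $\lambda$ is a bijection $Q\colon\lambda\to\{1,\dots,n\}$ such that $Q(i,j)$ increases in $i$ and in $j$; the set of these is $\mathfrak{st}_\lambda$. For $Q\in\mathfrak{st}_\lambda$, the linear order $\preccurlyeq_Q$ on the nodes is given by $\alpha\prec_Q\beta$ iff $Q(\alpha)<Q(\beta)$. Given $P,Q\in\mathfrak{st}_\lambda$, let $\alpha_1\prec_Q\alpha_2\prec_Q\dots\prec_Q\alpha_n$ be the list of all nodes of $\lambda$ enumerated according to $\preccurlyeq_Q$. A node $\alpha_k$ (with $1\le k<n$) is called a $(P,Q)$-disagreement node if $\alpha_{k+1}\prec_P\alpha_k$. The $P$-pedestal of $Q$ is the function $q_{P,Q}\colon\lambda\to\mathbb{Z}_{\ge 0}$ defined by $$q_{P,Q}(\alpha_k)=\#\{\,l : l<k,\ \alpha_l\text{ is a }(P,Q)\text{-disagreement node}\,\}.$$ *)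

theory Defs
  imports
    "HOL-Library.FuncSet"
    "HOL-Computational_Algebra.Polynomial_FPS"
begin

definition is_partition :: "nat \<Rightarrow> nat list \<Rightarrow> bool" where
  "is_partition n lam \<longleftrightarrow> sorted_wrt (\<ge>) lam \<and> (\<forall>p\<in>set lam. p > 0) \<and> sum_list lam = n"

(* Rows and columns are numbered from 1, list positions from 0. *)
definition young_diagram :: "nat list \<Rightarrow> (nat \<times> nat) set" where
  "young_diagram lam =
     {(i, j). 1 \<le> i \<and> i \<le> length lam \<and> 1 \<le> j \<and> j \<le> lam ! (i - 1)}"

definition hook_length :: "nat list \<Rightarrow> nat \<times> nat \<Rightarrow> nat" where
  "hook_length lam = (\<lambda>(i, j).
     card {(i', j'). (i', j') \<in> young_diagram lam \<and>
                     (i' = i \<and> j' \<ge> j \<or> j' = j \<and> i' > i)})"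

(* Membership in "extensional" fixes the irrelevant values outside the diagram, so that
   each tableau is represented by exactly one function. *)
definition std_tableaux :: "nat list \<Rightarrow> (nat \<times> nat \<Rightarrow> nat) set" where
  "std_tableaux lam =
     {Q \<in> extensional (young_diagram lam).
        bij_betw Q (young_diagram lam) {1..sum_list lam} \<and>
        (\<forall>i i' j. (i, j) \<in> young_diagram lam \<and> (i', j) \<in> young_diagram lam \<and> i < i'
             \<longrightarrow> Q (i, j) < Q (i', j)) \<and>
        (\<forall>i j j'. (i, j) \<in> young_diagram lam \<and> (i, j') \<in> young_diagram lam \<and> j < j'
             \<longrightarrow> Q (i, j) < Q (i, j'))}"

definition tableau_less :: "(nat \<times> nat \<Rightarrow> nat) \<Rightarrow> nat \<times> nat \<Rightarrow> nat \<times> nat \<Rightarrow> bool" where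
  "tableau_less Q a b \<longleftrightarrow> Q a < Q b"

(* The k-th node (k = 1, ..., n) in the enumeration of the nodes according to the order of Q.
   As Q is a bijection onto {1..n}, it is the node with entry k. *)
definition nth_node :: "nat list \<Rightarrow> (nat \<times> nat \<Rightarrow> nat) \<Rightarrow> nat \<Rightarrow> nat \<times> nat" where
  "nth_node lam Q k = inv_into (young_diagram lam) Q k"

definition disagreement_node ::
    "nat list \<Rightarrow> (nat \<times> nat \<Rightarrow> nat) \<Rightarrow> (nat \<times> nat \<Rightarrow> nat) \<Rightarrow> nat \<times> nat \<Rightarrow> bool" where
  "disagreement_node lam P Q a \<longleftrightarrow>
     (\<exists>k. 1 \<le> k \<and> k < sum_list lam \<and> a = nth_node lam Q k \<and>
          tableau_less P (nth_node lam Q (k + 1)) (nth_node lam Q k))"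

(* A node a of the diagram is the k-th node in the enumeration for k = Q a. *)
definition pedestal ::
    "nat list \<Rightarrow> (nat \<times> nat \<Rightarrow> nat) \<Rightarrow> (nat \<times> nat \<Rightarrow> nat) \<Rightarrow> nat \<times> nat \<Rightarrow> nat" where
  "pedestal lam P Q a =
     card {l. 1 \<le> l \<and> l < Q a \<and> disagreement_node lam P Q (nth_node lam Q l)}"

definition pedestal_size ::
    "nat list \<Rightarrow> (nat \<times> nat \<Rightarrow> nat) \<Rightarrow> (nat \<times> nat \<Rightarrow> nat) \<Rightarrow> nat" where
  "pedestal_size lam P Q = (\<Sum>a\<in>young_diagram lam. pedestal lam P Q a)"

definition pedestal_poly ::
    "nat list \<Rightarrow> (nat \<times> nat \<Rightarrow> nat) \<Rightarrow> 'a::comm_semiring_1 poly" where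
  "pedestal_poly lam P = (\<Sum>Q\<in>std_tableaux lam. monom 1 (pedestal_size lam P Q))"

end

theory Submission
  imports Defs
begin

text \<open>
  Both sides enumerate the reverse plane partitions of shape \<open>\<lambda>\<close> (fillings of the diagram with
  natural numbers that increase weakly along rows and columns) by the sum of their entries.

  For the hook side, remove a corner \<open>c\<close> of the diagram and apply the piecewise linear toggle
  \<open>f x \<mapsto> min (below, right) + max (above, left) - f x\<close> to the other nodes of the diagonal of \<open>c\<close>.
  This gives, by induction, a bijection from arbitrary fillings \<open>A\<close> to reverse plane partitions
  under which the sum along the diagonal of content \<open>k\<close> becomes the sum of \<open>A\<close> over the rectangle
  spanned by the last node of that diagonal. A node \<open>u\<close> lies in this rectangle iff the hook of
  \<open>u\<close> meets the diagonal, so \<open>A u\<close> is counted \<open>h\<^sub>u\<close> times in the total.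

  For the pedestal side, sort the nodes by their entry, breaking ties by \<open>P\<close>. The resulting
  tableau \<open>Q\<close> has the property that the entries minus the pedestal of \<open>Q\<close> still increase weakly
  along \<open>Q\<close>, so that reverse plane partitions correspond to pairs of a standard tableau and a
  sequence of \<open>n\<close> nonnegative increments.
\<close>

section \<open>Toggling along a diagonal\<close>

definition node_content :: "nat \<times> nat \<Rightarrow> int" where
  "node_content x = int (snd x) - int (fst x)"

text \<open>A Young diagram as a finite order ideal of nodes with positive coordinates. As a set of
  nodes, it stays in this class when a corner is removed, with no row lengths to adjust.\<close>

definition diagram :: "(nat \<times> nat) set \<Rightarrow> bool" where
  "diagram D \<longleftrightarrow> finite D \<and> (\<forall>(i, j)\<in>D. 1 \<le> i \<and> 1 \<le> j \<and> {1..i} \<times> {1..j} \<subseteq> D)"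

definition supported :: "'a set \<Rightarrow> ('a \<Rightarrow> nat) set" where
  "supported S = {f. \<forall>x. x \<notin> S \<longrightarrow> f x = 0}"

definition rpp :: "(nat \<times> nat) set \<Rightarrow> (nat \<times> nat \<Rightarrow> nat) set" where
  "rpp D = {f \<in> supported D. \<forall>i j.
     ((Suc i, j) \<in> D \<longrightarrow> f (i, j) \<le> f (Suc i, j)) \<and>
     ((i, Suc j) \<in> D \<longrightarrow> f (i, j) \<le> f (i, Suc j))}"

definition trace :: "(nat \<times> nat) set \<Rightarrow> (nat \<times> nat \<Rightarrow> nat) \<Rightarrow> int \<Rightarrow> nat" where
  "trace D f k = (\<Sum>x | x \<in> D \<and> node_content x = k. f x)"

text \<open>
  The rectangle of all nodes weakly above and to the left of the last node of content \<open>k\<close>.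
\<close>

definition rect :: "(nat \<times> nat) set \<Rightarrow> int \<Rightarrow> (nat \<times> nat) set" where
  "rect D k = {u \<in> D. \<exists>v\<in>D. node_content v = k \<and> fst u \<le> fst v \<and> snd u \<le> snd v}"

text \<open>
  Nodes are numbered from 1, so a supported \<open>f\<close> is \<open>0\<close> at \<open>(0, j)\<close> and \<open>(i, 0)\<close>; no boundary
  cases are needed here.
\<close>

definition lower :: "(nat \<times> nat \<Rightarrow> nat) \<Rightarrow> nat \<times> nat \<Rightarrow> nat" where
  "lower f = (\<lambda>(i, j). max (f (i - 1, j)) (f (i, j - 1)))"

text \<open>Evaluated by the toggle only at nodes whose neighbours below and to the right both
  belong to the shape (\<open>toggled_step\<close>), so the default value 0 never enters the minimum
  there.\<close>

definition upper :: "(nat \<times> nat \<Rightarrow> nat) \<Rightarrow> nat \<times> nat \<Rightarrow> nat" where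
  "upper f = (\<lambda>(i, j). min (f (Suc i, j)) (f (i, Suc j)))"

lemma diagramD:
  assumes "diagram D" "(i, j) \<in> D" "1 \<le> i'" "i' \<le> i" "1 \<le> j'" "j' \<le> j"
  shows "(i', j') \<in> D"
  using assms unfolding diagram_def by fastforce

lemma diagram_pos:
  assumes "diagram D" "(i, j) \<in> D"
  shows "0 < i" "0 < j"
  using assms unfolding diagram_def by fastforce+

lemma rpp_supported: "f \<in> rpp C \<Longrightarrow> x \<notin> C \<Longrightarrow> f x = 0"
  unfolding rpp_def supported_def by blast

section \<open>A removable corner and the toggle on its diagonal\<close>

locale corner =
  fixes D :: "(nat \<times> nat) set" and r s :: nat
  assumes diag: "diagram D"
    and corner_in: "(r, s) \<in> D"
    and no_below: "(Suc r, s) \<notin> D"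
    and no_right: "(r, Suc s) \<notin> D"
begin

abbreviation "E \<equiv> D - {(r, s)}"

text \<open>The equation says that \<open>x\<close> has the content of the corner, stated without
  subtraction; membership in \<open>E\<close> excludes the corner itself.\<close>

definition toggled :: "nat \<times> nat \<Rightarrow> bool" where
  "toggled x \<longleftrightarrow> x \<in> E \<and> fst x + s = snd x + r"

definition toggle :: "(nat \<times> nat \<Rightarrow> nat) \<Rightarrow> nat \<times> nat \<Rightarrow> nat" where
  "toggle f x = (if toggled x then lower f x + upper f x - f x else f x)"

text \<open>The corner has no neighbour below or to the right, so its entry is bounded only from
  below. The parameter \<open>a\<close> is the free excess over that bound.\<close>

definition add_corner :: "(nat \<times> nat \<Rightarrow> nat) \<Rightarrow> nat \<Rightarrow> nat \<times> nat \<Rightarrow> nat" where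
  "add_corner f a = (toggle f)((r, s) := a + lower f (r, s))"

text \<open>The toggle is its own inverse on the relevant fillings, so it also serves for deletion.
  Resetting the corner to 0 makes the result supported on \<open>E\<close>.\<close>

definition del_corner :: "(nat \<times> nat \<Rightarrow> nat) \<Rightarrow> nat \<times> nat \<Rightarrow> nat" where
  "del_corner g = (toggle g)((r, s) := 0)"

lemma finite_D: "finite D"
  using diag by (simp add: diagram_def)

lemma rs_pos: "0 < r" "0 < s"
  using diagram_pos[OF diag corner_in] by auto

lemma not_beyond:
  assumes "(i, j) \<in> D" "r \<le> i" "s \<le> j"
  shows "i = r" "j = s"
proof -
  have "\<not> Suc r \<le> i"
    using diagramD[OF diag assms(1), of "Suc r" s] no_below assms rs_pos by auto
  moreover have "\<not> Suc s \<le> j"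
    using diagramD[OF diag assms(1), of r "Suc s"] no_right assms rs_pos by auto
  ultimately show "i = r" "j = s" using assms by auto
qed

text \<open>Two nodes of equal content are comparable in both coordinates at once, and
  \<open>not_beyond\<close> rules out the nodes past the corner.\<close>

lemma toggled_less:
  assumes "toggled (i, j)"
  shows "i < r" "j < s" "0 < i" "0 < j" "(i, j) \<in> D" "i + s = j + r"
proof -
  show *: "(i, j) \<in> D" "i + s = j + r" using assms by (auto simp: toggled_def)
  show "0 < i" "0 < j" using diagram_pos[OF diag *(1)] by auto
  have "\<not> (r \<le> i \<and> s \<le> j)"
    using not_beyond[OF *(1)] assms by (auto simp: toggled_def)
  then show "i < r" "j < s" using *(2) by auto
qed

lemma toggled_step:
  assumes "toggled (i, j)"
  shows "(Suc i, j) \<in> E" "(i, Suc j) \<in> E"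
  using diagramD[OF diag corner_in, of "Suc i" j] diagramD[OF diag corner_in, of i "Suc j"]
    toggled_less[OF assms] by auto

lemma diagram_E: "diagram E"
  unfolding diagram_def
proof (intro conjI ballI, simp add: finite_D)
  fix x assume x: "x \<in> E"
  obtain i j where ij: "x = (i, j)" by force
  have *: "(i', j') \<in> E" if "1 \<le> i'" "i' \<le> i" "1 \<le> j'" "j' \<le> j" for i' j'
  proof -
    have "(i, j) \<in> D" "(i, j) \<noteq> (r, s)" using x ij by auto
    then have "\<not> (r \<le> i \<and> s \<le> j)" using not_beyond by blast
    then show ?thesis using diagramD[OF diag \<open>(i, j) \<in> D\<close> that] that by auto
  qed
  have "{1..i} \<times> {1..j} \<subseteq> E" by (intro subrelI *) auto
  then show "case x of (i, j) \<Rightarrow> 1 \<le> i \<and> 1 \<le> j \<and> {1..i} \<times> {1..j} \<subseteq> E"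
    using diagram_pos[OF diag, of i j] x ij by (simp add: Suc_le_eq)
qed

text \<open>The conditions in \<open>rpp\<close> at index 0 compare the first row and column with
  the zero boundary, so every node of \<open>C\<close> is covered.\<close>

lemma lower_le:
  assumes "diagram C" "f \<in> rpp C" "x \<in> C"
  shows "lower f x \<le> f x"
proof -
  obtain i j where x: "x = (i, j)" by force
  then obtain i' j' where "i = Suc i'" "j = Suc j'"
    using diagram_pos[OF assms(1), of i j] assms(3) gr0_implies_Suc by blast
  then show ?thesis using assms x by (auto simp: rpp_def lower_def)
qed

lemma le_upper:
  assumes "f \<in> rpp C" "E \<subseteq> C" "toggled x"
  shows "f x \<le> upper f x"
proof -
  obtain i j where x: "x = (i, j)" by force
  show ?thesis using toggled_step[of i j] assms x by (auto simp: rpp_def upper_def)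
qed

text \<open>The toggle reflects the entry in the interval from \<open>lower f x\<close> to
  \<open>upper f x\<close>. Hence the subtraction is not truncated, the new entry stays in the
  interval, and a second reflection restores the old one. A general \<open>C\<close> allows both
  \<open>E\<close> and \<open>D\<close>.\<close>

lemma toggle_bounds:
  assumes "diagram C" "f \<in> rpp C" "E \<subseteq> C" "toggled x"
  shows "lower f x \<le> toggle f x" "toggle f x \<le> upper f x" "lower f x + upper f x - toggle f x = f x"
    "f x + toggle f x = lower f x + upper f x"
proof -
  have "x \<in> C" using assms by (auto simp: toggled_def)
  then have "lower f x \<le> f x" "f x \<le> upper f x"
    using lower_le[OF assms(1,2)] le_upper[OF assms(2-4)] by auto
  then show "lower f x \<le> toggle f x" "toggle f x \<le> upper f x" "lower f x + upper f x - toggle f x = f x"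
    "f x + toggle f x = lower f x + upper f x"
    using assms(4) by (auto simp: toggle_def)
qed

lemma toggle_off: "\<not> toggled x \<Longrightarrow> toggle f x = f x"
  by (simp add: toggle_def)

lemma neighbours_untoggled:
  assumes "i + s = j + r" "0 < i" "0 < j"
  shows "\<not> toggled (i - 1, j)" "\<not> toggled (i, j - 1)" "\<not> toggled (Suc i, j)" "\<not> toggled (i, Suc j)"
  using assms by (auto simp: toggled_def)

text \<open>The neighbours of a node on the diagonal of the corner lie on the two adjacent
  diagonals. Neither toggling nor overwriting the corner touches these, so the interval of
  reflection is the same before and after.\<close>

lemma lower_cong:
  assumes "i + s = j + r" "0 < i" "0 < j"
  shows "lower ((toggle f)((r, s) := a)) (i, j) = lower f (i, j)"
  using neighbours_untoggled[OF assms] assms by (auto simp: lower_def toggle_off)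

lemma upper_cong:
  assumes "i + s = j + r" "0 < i" "0 < j"
  shows "upper ((toggle f)((r, s) := a)) (i, j) = upper f (i, j)"
  using neighbours_untoggled[OF assms] assms by (auto simp: upper_def toggle_off)

text \<open>A reflection in an unchanged interval is an involution. The corner values
  \<open>a\<close> and \<open>b\<close> are arbitrary so that both compositions of adding and
  deleting are instances.\<close>

lemma toggle_toggle:
  assumes "diagram C" "f \<in> rpp C" "E \<subseteq> C"
  shows "(toggle ((toggle f)((r, s) := a)))((r, s) := b) = f((r, s) := b)"
proof
  fix x :: "nat \<times> nat"
  obtain i j where x: "x = (i, j)" by force
  show "((toggle ((toggle f)((r, s) := a)))((r, s) := b)) x = (f((r, s) := b)) x"
  proof (cases "toggled x")
    case True
    then have "x \<noteq> (r, s)" by (auto simp: toggled_def)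
    moreover have "toggle ((toggle f)((r, s) := a)) x = lower f x + upper f x - toggle f x"
      using True toggled_less[of i j] x \<open>x \<noteq> (r, s)\<close>
      by (subst toggle_def) (simp add: lower_cong upper_cong)
    ultimately show ?thesis using toggle_bounds(3)[OF assms True] by simp
  next
    case False
    then show ?thesis by (simp add: toggle_off)
  qed
qed

text \<open>Adjacent nodes have different contents, so at most one of the two is toggled; its new
  entry is still within the bounds set by its neighbours.\<close>

lemma toggle_rpp_step:
  assumes C: "diagram C" "f \<in> rpp C" "E \<subseteq> C" "C \<subseteq> D"
    and x: "(i, j) \<in> E" and y: "y = (i - 1, j) \<or> y = (i, j - 1)"
  shows "toggle f y \<le> toggle f (i, j)"
proof -
  have pos: "0 < i" "0 < j" using diagram_pos[OF diag, of i j] x by auto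
  have xC: "(i, j) \<in> C" using x C(3) by auto
  have ylow: "f y \<le> lower f (i, j)" using y by (auto simp: lower_def)
  consider "toggled (i, j)" | "\<not> toggled (i, j)" "toggled y" | "\<not> toggled (i, j)" "\<not> toggled y" by blast
  then show ?thesis
  proof cases
    case 1
    then have "\<not> toggled y"
      using neighbours_untoggled[of i j] toggled_less[of i j] y by auto
    then have "toggle f y = f y" by (rule toggle_off)
    then show ?thesis using ylow toggle_bounds(1)[OF C(1-3) 1] by simp
  next
    case 2
    \<comment> \<open>Here \<open>(i, j)\<close> is the node below or to the right of
      \<open>y\<close>, so its entry is one of the two in the minimum.\<close>
    have "upper f y \<le> f (i, j)" using y pos by (auto simp: upper_def)
    then show ?thesis using toggle_bounds(2)[OF C(1-3) 2(2)] toggle_off[OF 2(1)] by simp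
  next
    case 3
    then show ?thesis using ylow lower_le[OF C(1,2) xC] by (simp add: toggle_off)
  qed
qed

lemma rppI:
  assumes "diagram C" "f \<in> supported C"
    and "\<And>i j y. (i, j) \<in> C \<Longrightarrow> y = (i - 1, j) \<or> y = (i, j - 1) \<Longrightarrow> f y \<le> f (i, j)"
  shows "f \<in> rpp C"
proof -
  have "f (i, j) \<le> f (Suc i, j)" if "(Suc i, j) \<in> C" for i j
    using assms(3)[OF that, of "(i, j)"] by simp
  moreover have "f (i, j) \<le> f (i, Suc j)" if "(i, Suc j) \<in> C" for i j
    using assms(3)[OF that, of "(i, j)"] by simp
  ultimately show ?thesis using assms(2) unfolding rpp_def by blast
qed

section \<open>Adding and deleting the corner as inverse operations\<close>

lemma add_corner_rpp:
  assumes "f \<in> rpp E"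
  shows "add_corner f a \<in> rpp D"
proof (rule rppI[OF diag])
  show "add_corner f a \<in> supported D"
    using assms corner_in rpp_supported
    by (auto simp: supported_def add_corner_def toggle_def toggled_def)
next
  fix i j y assume ij: "(i, j) \<in> D" and y: "y = (i - 1, j) \<or> y = (i, j - 1)"
  have pos: "0 < i" "0 < j" using diagram_pos[OF diag ij] by auto
  \<comment> \<open>The corner is never the upper or left neighbour of a node of \<open>D\<close>,
    so its new entry need not be compared with any larger one.\<close>
  have yc: "y \<noteq> (r, s)"
  proof
    assume "y = (r, s)"
    then have "(i, j) = (Suc r, s) \<or> (i, j) = (r, Suc s)" using y pos by auto
    then show False using ij no_below no_right by auto
  qed
  show "add_corner f a y \<le> add_corner f a (i, j)"
  proof (cases "(i, j) = (r, s)")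
    case True
    then have "\<not> toggled y" using neighbours_untoggled[of r s] y rs_pos by auto
    then have "add_corner f a y = f y" using yc by (simp add: add_corner_def toggle_off)
    also have "\<dots> \<le> lower f (r, s)" using True y by (auto simp: lower_def)
    also have "\<dots> \<le> add_corner f a (i, j)" using True by (simp add: add_corner_def)
    finally show ?thesis .
  next
    case False
    then show ?thesis
      using toggle_rpp_step[OF diagram_E assms, of i j y] ij y yc by (auto simp: add_corner_def)
  qed
qed

lemma del_corner_rpp:
  assumes "g \<in> rpp D"
  shows "del_corner g \<in> rpp E"
proof (rule rppI[OF diagram_E])
  show "del_corner g \<in> supported E"
    using assms rpp_supported
    by (auto simp: supported_def del_corner_def toggle_def toggled_def)
next
  fix i j y assume ij: "(i, j) \<in> E" and y: "y = (i - 1, j) \<or> y = (i, j - 1)"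
  then show "del_corner g y \<le> del_corner g (i, j)"
    using toggle_rpp_step[OF diag assms, of i j y] by (auto simp: del_corner_def)
qed

lemma lower_add_corner: "lower (add_corner f a) (r, s) = lower f (r, s)"
  unfolding add_corner_def using rs_pos by (intro lower_cong) auto

lemma lower_del_corner: "lower (del_corner f) (r, s) = lower f (r, s)"
  unfolding del_corner_def using rs_pos by (intro lower_cong) auto

lemma del_add_corner:
  assumes "f \<in> rpp E"
  shows "del_corner (add_corner f a) = f"
proof -
  have "del_corner (add_corner f a) = f((r, s) := 0)"
    unfolding del_corner_def add_corner_def
    by (rule toggle_toggle[OF diagram_E assms]) simp
  also have "\<dots> = f" using rpp_supported[OF assms, of "(r, s)"] by auto
  finally show ?thesis .
qed

text \<open>The excess is recovered as the corner entry minus its lower bound. Deletion leaves that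
  bound unchanged, and \<open>lower_le\<close> makes the subtraction exact.\<close>

lemma add_del_corner:
  assumes "g \<in> rpp D"
  shows "add_corner (del_corner g) (g (r, s) - lower g (r, s)) = g"
proof -
  have "lower g (r, s) \<le> g (r, s)" using lower_le[OF diag assms corner_in] .
  then have "add_corner (del_corner g) (g (r, s) - lower g (r, s))
      = (toggle (del_corner g))((r, s) := g (r, s))"
    by (simp add: add_corner_def lower_del_corner)
  also have "\<dots> = g((r, s) := g (r, s))"
    unfolding del_corner_def by (rule toggle_toggle[OF diag assms]) auto
  finally show ?thesis by simp
qed

section \<open>Traces and rectangle sums: the common recurrence\<close>

lemma diagonal_sum:
  assumes "\<And>i j. i = 0 \<or> j = 0 \<Longrightarrow> f (i, j) = 0"
    and "(r', s') \<in> D \<or> r' = 0 \<or> s' = 0" "(Suc r', Suc s') \<notin> D" "int s' - int r' = k"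
  shows "trace D f k = (\<Sum>d<min r' s'. f (r' - d, s' - d))"
proof -
  have "bij_betw (\<lambda>d. (r' - d, s' - d)) {..<min r' s'} {x. x \<in> D \<and> node_content x = k}"
  proof (rule bij_betwI[where g = "\<lambda>x. r' - fst x"])
    show "(\<lambda>d. (r' - d, s' - d)) \<in> {..<min r' s'} \<rightarrow> {x. x \<in> D \<and> node_content x = k}"
      using assms(2,4) diagramD[OF diag, of r' s'] by (auto simp: node_content_def)
    \<comment> \<open>The point \<open>(r', s')\<close> ends the diagonal: a later node of content
      \<open>k\<close> would force \<open>(Suc r', Suc s')\<close> into \<open>D\<close>. If
      \<open>r'\<close> or \<open>s'\<close> is 0, the diagonal is empty.\<close>
    have less: "i \<le> r' \<and> j \<le> s' \<and> 0 < i \<and> 0 < j" if "(i, j) \<in> D" "int j - int i = k" for i j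
    proof -
      have p: "0 < i" "0 < j" using diagram_pos[OF diag that(1)] by auto
      have "\<not> (Suc r' \<le> i \<and> Suc s' \<le> j)"
        using diagramD[OF diag that(1), of "Suc r'" "Suc s'"] assms(3) by auto
      then show ?thesis using that(2) assms(4) p by auto
    qed
    show "(\<lambda>x. r' - fst x) \<in> {x. x \<in> D \<and> node_content x = k} \<rightarrow> {..<min r' s'}"
      using assms(4) by (auto simp: node_content_def dest!: less)
    show "\<And>x. x \<in> {..<min r' s'} \<Longrightarrow> r' - fst (r' - x, s' - x) = x" by auto
    show "\<And>y. y \<in> {x. x \<in> D \<and> node_content x = k} \<Longrightarrow> (r' - (r' - fst y), s' - (r' - fst y)) = y"
      using assms(4) less by (fastforce simp: node_content_def)
  qed
  then show ?thesis unfolding trace_def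
    by (subst sum.reindex_bij_betw[symmetric]) auto
qed

lemma trace_add_corner_other:
  assumes "k \<noteq> int s - int r"
  shows "trace D (add_corner f a) k = trace E f k"
proof -
  have "{x. x \<in> D \<and> node_content x = k} = {x. x \<in> E \<and> node_content x = k}"
    using assms by (auto simp: node_content_def)
  then show ?thesis unfolding trace_def
    using assms by (auto simp: add_corner_def toggle_def toggled_def node_content_def intro!: sum.cong)
qed

lemma trace_E:
  assumes "f \<in> rpp E"
  shows "trace E f k = trace D f k"
  unfolding trace_def
  using finite_D rpp_supported[OF assms] by (intro sum.mono_neutral_left) auto

text \<open>Old plus new entry at a toggled node is a maximum over the neighbours above and left
  plus a minimum over those below and right. Along the diagonal, the minimum at one node uses the
  same two entries as the maximum at the next node towards the corner, and a maximum plus a minimum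
  is a plain sum.\<close>

lemma trace_add_corner:
  assumes f: "f \<in> rpp E" and k: "k = int s - int r"
  shows "trace D (add_corner f a) k + trace E f k = trace E f (k - 1) + trace E f (k + 1) + a"
proof -
  define m where "m = min r s"
  have m: "0 < m" using rs_pos by (simp add: m_def)
  have z: "f (i, j) = 0" if "i = 0 \<or> j = 0" for i j
    using rpp_supported[OF f] diagram_pos[OF diag, of i j] that by auto
  have g: "add_corner f a \<in> rpp D" by (rule add_corner_rpp[OF f])
  have gz: "add_corner f a (i, j) = 0" if "i = 0 \<or> j = 0" for i j
    using rpp_supported[OF g] diagram_pos[OF diag, of i j] that by auto
  have out: "(Suc r, Suc s) \<notin> D" using not_beyond[of "Suc r" "Suc s"] by auto
  have tk: "trace D h k = (\<Sum>d<m. h (r - d, s - d))" if "\<And>i j. i = 0 \<or> j = 0 \<Longrightarrow> h (i, j) = 0" for h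
    unfolding m_def using that corner_in out k by (intro diagonal_sum) auto
  \<comment> \<open>The adjacent diagonals may have one node fewer than \<open>m\<close>; the extra
    terms lie in row 0 or column 0 and vanish.\<close>
  have ext: "(\<Sum>d<min r' s'. f (r' - d, s' - d)) = (\<Sum>d<m. f (r' - d, s' - d))" if "min r' s' \<le> m" for r' s'
    using that by (intro sum.mono_neutral_left) (auto intro!: z simp: min_le_iff_disj)
  \<comment> \<open>The diagonal to the left ends at \<open>(r, s - 1)\<close>, since
    \<open>(Suc r, s)\<close> is not in \<open>D\<close>; it is empty when
    \<open>s = 1\<close>.\<close>
  have "trace D f (k - 1) = (\<Sum>d<min r (s - 1). f (r - d, s - 1 - d))"
    using z k rs_pos no_below diagramD[OF diag corner_in, of r "s - 1"] by (intro diagonal_sum) auto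
  then have tl: "trace D f (k - 1) = (\<Sum>d<m. f (r - d, s - 1 - d))"
    using ext[of r "s - 1"] by (simp add: m_def)
  have "trace D f (k + 1) = (\<Sum>d<min (r - 1) s. f (r - 1 - d, s - d))"
    using z k rs_pos no_right diagramD[OF diag corner_in, of "r - 1" s] by (intro diagonal_sum) auto
  then have tu: "trace D f (k + 1) = (\<Sum>d<m. f (r - 1 - d, s - d))"
    using ext[of "r - 1" s] by (simp add: m_def)
  \<comment> \<open>At distance \<open>d\<close> from the corner, \<open>p d\<close> is the entry to
    the left and \<open>q d\<close> the entry above. These are also the entries below and to the
    right of the node at distance \<open>Suc d\<close>.\<close>
  define p where "p d = f (r - d, s - 1 - d)" for d
  define q where "q d = f (r - 1 - d, s - d)" for d
  obtain l where l: "m = Suc l" using m gr0_implies_Suc by blast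
  have low: "lower f (r - d, s - d) = max (p d) (q d)" for d
    by (simp add: lower_def p_def q_def diff_commute max.commute)
  have tog: "add_corner f a (r - Suc d, s - Suc d) + f (r - Suc d, s - Suc d)
      = max (p (Suc d)) (q (Suc d)) + min (p d) (q d)" if "d < l" for d
  proof -
    have d: "Suc d < r" "Suc d < s" using that l by (auto simp: m_def)
    have t: "toggled (r - Suc d, s - Suc d)"
      using d diagramD[OF diag corner_in, of "r - Suc d" "s - Suc d"] by (auto simp: toggled_def)
    have "upper f (r - Suc d, s - Suc d) = min (p d) (q d)"
      using d by (simp add: upper_def p_def q_def Suc_diff_Suc)
    moreover have "r - Suc d \<noteq> r" using d by simp
    ultimately show ?thesis
      using toggle_bounds(4)[OF diagram_E f subset_refl t] low[of "Suc d"]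
      by (simp add: add_corner_def)
  qed
  \<comment> \<open>The node at distance \<open>l\<close> lies in the first row or column, so one of
    its two entries is a boundary 0 and the unpaired maximum is a sum as well.\<close>
  have last: "max (p l) (q l) = p l + q l"
  proof -
    have "p l = 0 \<or> q l = 0"
      using l z by (auto simp: p_def q_def m_def min_def split: if_splits)
    then show ?thesis by auto
  qed
  have max_add_min: "max x y + min x y = x + y" for x y :: nat by simp
  have "trace D (add_corner f a) k + trace D f k
      = (\<Sum>d<m. add_corner f a (r - d, s - d) + f (r - d, s - d))"
    using tk[of f] tk[of "add_corner f a"] z gz by (simp add: sum.distrib)
  also have "\<dots> = a + max (p 0) (q 0) + (\<Sum>d<l. max (p (Suc d)) (q (Suc d)) + min (p d) (q d))"
    using low[of 0] tog rpp_supported[OF f, of "(r, s)"]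
    by (simp add: l sum.lessThan_Suc_shift add_corner_def del: sum.lessThan_Suc)
  also have "\<dots> = a + ((\<Sum>d<m. max (p d) (q d)) + (\<Sum>d<l. min (p d) (q d)))"
    by (simp add: l sum.lessThan_Suc_shift sum.distrib del: sum.lessThan_Suc)
  \<comment> \<open>Regrouping pairs the maximum and the minimum with the same index; only the
    maximum at \<open>l\<close> stays alone.\<close>
  also have "\<dots> = a + ((\<Sum>d<l. max (p d) (q d) + min (p d) (q d)) + max (p l) (q l))"
    by (simp add: l sum.distrib)
  also have "\<dots> = a + (\<Sum>d<m. p d + q d)"
    using last by (simp add: l max_add_min)
  finally show ?thesis
    by (simp add: trace_E[OF f] tl tu sum.distrib p_def q_def)
qed

lemma rect_box:
  assumes "(r', s') \<in> D \<or> r' = 0 \<or> s' = 0" "(Suc r', Suc s') \<notin> D" "int s' - int r' = k"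
  shows "rect D k = {1..r'} \<times> {1..s'}"
proof (rule set_eqI)
  fix u :: "nat \<times> nat"
  obtain i j where u: "u = (i, j)" by force
  show "u \<in> rect D k \<longleftrightarrow> u \<in> {1..r'} \<times> {1..s'}"
  proof
    assume "u \<in> rect D k"
    then obtain a b where v: "(i, j) \<in> D" "(a, b) \<in> D" "int b - int a = k" "i \<le> a" "j \<le> b"
      by (auto simp: rect_def u node_content_def)
    have "\<not> (Suc r' \<le> a \<and> Suc s' \<le> b)"
      using diagramD[OF diag v(2), of "Suc r'" "Suc s'"] assms(2) by auto
    then show "u \<in> {1..r'} \<times> {1..s'}"
      using v diagram_pos[OF diag v(1)] assms(3) by (auto simp: u)
  next
    assume "u \<in> {1..r'} \<times> {1..s'}"
    then show "u \<in> rect D k"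
      using assms diagramD[OF diag, of r' s' i j] by (force simp: rect_def u node_content_def)
  qed
qed

text \<open>A rectangle of another content cannot contain the corner, and the nodes that span it
  survive the removal of the corner.\<close>

lemma rect_E_other:
  assumes "k \<noteq> int s - int r"
  shows "rect E k = rect D k"
proof (intro set_eqI iffI)
  fix u assume "u \<in> rect D k"
  then obtain a b where v: "u \<in> D" "(a, b) \<in> D" "node_content (a, b) = k" "fst u \<le> a" "snd u \<le> b"
    by (auto simp: rect_def)
  then have ne: "(a, b) \<noteq> (r, s)" using assms by (auto simp: node_content_def)
  then have "u \<noteq> (r, s)" using not_beyond[of a b] v by auto
  then have "u \<in> E" "(a, b) \<in> E" using v ne by auto
  then show "u \<in> rect E k" unfolding rect_def using v by force
qed (auto simp: rect_def)

lemma rect_E: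
  assumes "k = int s - int r"
  shows "rect E k = {1..r - 1} \<times> {1..s - 1}"
proof (rule set_eqI)
  fix u :: "nat \<times> nat"
  obtain i j where u: "u = (i, j)" by force
  show "u \<in> rect E k \<longleftrightarrow> u \<in> {1..r - 1} \<times> {1..s - 1}"
  proof
    assume "u \<in> rect E k"
    then obtain a b where v: "(i, j) \<in> D" "(a, b) \<in> E" "int b - int a = k" "i \<le> a" "j \<le> b"
      unfolding rect_def u node_content_def by force
    then have "toggled (a, b)" using assms by (auto simp: toggled_def)
    then show "u \<in> {1..r - 1} \<times> {1..s - 1}"
      using v diagram_pos[OF diag v(1)] toggled_less[of a b] by (auto simp: u)
  next
    assume "u \<in> {1..r - 1} \<times> {1..s - 1}"
    moreover from this have "(r - 1, s - 1) \<in> E" "(i, j) \<in> E"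
      using diagramD[OF diag corner_in, of "r - 1" "s - 1"] diagramD[OF diag corner_in, of i j]
      by (auto simp: u)
    ultimately show "u \<in> rect E k"
      using assms by (force simp: rect_def u node_content_def)
  qed
qed

text \<open>Inclusion-exclusion: the rectangles of contents \<open>k - 1\<close> and
  \<open>k + 1\<close> meet in the rectangle of \<open>E\<close> for \<open>k\<close>, and their
  union together with the corner is the rectangle of \<open>D\<close>. This matches the recurrence
  in \<open>trace_add_corner\<close>.\<close>

lemma rect_sum_corner:
  fixes A :: "nat \<times> nat \<Rightarrow> nat"
  assumes k: "k = int s - int r" and A': "A' = A((r, s) := 0)"
  shows "sum A (rect D k) + sum A' (rect E k)
     = sum A' (rect E (k - 1)) + sum A' (rect E (k + 1)) + A (r, s)"
proof -
  have out: "(Suc r, Suc s) \<notin> D" using not_beyond[of "Suc r" "Suc s"] by auto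
  have 0: "rect D k = {1..r} \<times> {1..s}"
    using corner_in out k by (intro rect_box) auto
  have 1: "rect E (k - 1) = {1..r} \<times> {1..s - 1}"
    using k rs_pos no_below diagramD[OF diag corner_in, of r "s - 1"]
    by (subst rect_E_other, simp, intro rect_box) auto
  have 2: "rect E (k + 1) = {1..r - 1} \<times> {1..s}"
    using k rs_pos no_right diagramD[OF diag corner_in, of "r - 1" s]
    by (subst rect_E_other, simp, intro rect_box) auto
  have *: "sum A' S = sum A S" if "(r, s) \<notin> S" for S
    using that by (auto simp: A' intro!: sum.cong)
  have inter: "rect E (k - 1) \<inter> rect E (k + 1) = rect E k"
    unfolding 1 2 rect_E[OF k] by auto
  have union: "rect D k = insert (r, s) (rect E (k - 1) \<union> rect E (k + 1))"
    unfolding 0 1 2 using rs_pos by auto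
  have nin: "(r, s) \<notin> rect E k'" for k'
    by (simp add: rect_def)
  have fin: "finite (rect E k')" for k'
    using finite_D by (auto simp: rect_def)
  have "sum A (rect D k) + sum A (rect E k)
      = A (r, s) + (sum A (rect E (k - 1) \<union> rect E (k + 1)) + sum A (rect E (k - 1) \<inter> rect E (k + 1)))"
    using fin nin by (simp add: union inter)
  also have "\<dots> = A (r, s) + (sum A (rect E (k - 1)) + sum A (rect E (k + 1)))"
    using sum.union_inter[OF fin fin, of A] by simp
  finally show ?thesis using *[OF nin] by simp
qed

text \<open>The entry of \<open>A\<close> at the corner becomes the excess there, and the rest of
  \<open>A\<close> passes through \<open>\<phi>\<close>. Traces and rectangle sums obey the same
  recurrence on the diagonal of the corner and do not change on the other diagonals.\<close>

lemma bij_step: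
  assumes \<phi>: "bij_betw \<phi> (supported E) (rpp E)"
    and tr: "\<And>A k. A \<in> supported E \<Longrightarrow> trace E (\<phi> A) k = sum A (rect E k)"
  shows "\<exists>\<psi>. bij_betw \<psi> (supported D) (rpp D) \<and>
    (\<forall>A\<in>supported D. \<forall>k. trace D (\<psi> A) k = sum A (rect D k))"
proof (intro exI conjI ballI allI)
  let ?\<psi> = "\<lambda>A. add_corner (\<phi> (A((r, s) := 0))) (A (r, s))"
  let ?\<phi>' = "inv_into (supported E) \<phi>"
  have res: "A((r, s) := 0) \<in> supported E" if "A \<in> supported D" for A
    using that by (auto simp: supported_def)
  have \<phi>_in: "\<phi> A \<in> rpp E" if "A \<in> supported E" for A
    using \<phi> that by (auto simp: bij_betw_def)
  have \<phi>'_in: "?\<phi>' f \<in> supported E" if "f \<in> rpp E" for f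
    using \<phi> that inv_into_into[of f \<phi> "supported E"] by (auto simp: bij_betw_def)
  show "bij_betw ?\<psi> (supported D) (rpp D)"
  \<comment> \<open>The inverse deletes the corner, inverts \<open>\<phi>\<close>, and stores the
    excess over \<open>lower g\<close> as the value at the corner.\<close>
  proof (rule bij_betwI[where g = "\<lambda>g. (?\<phi>' (del_corner g))((r, s) := g (r, s) - lower g (r, s))"])
    show "?\<psi> \<in> supported D \<rightarrow> rpp D"
      using res \<phi>_in add_corner_rpp by auto
    show "(\<lambda>g. (?\<phi>' (del_corner g))((r, s) := g (r, s) - lower g (r, s))) \<in> rpp D \<rightarrow> supported D"
    proof
      fix g assume "g \<in> rpp D"
      then have "?\<phi>' (del_corner g) \<in> supported E" using \<phi>'_in del_corner_rpp by auto
      then show "(?\<phi>' (del_corner g))((r, s) := g (r, s) - lower g (r, s)) \<in> supported D"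
        using corner_in by (auto simp: supported_def)
    qed
  next
    fix A assume A: "A \<in> supported D"
    have "?\<psi> A (r, s) - lower (?\<psi> A) (r, s) = A (r, s)"
      by (simp only: lower_add_corner) (simp add: add_corner_def)
    moreover have "?\<phi>' (del_corner (?\<psi> A)) = A((r, s) := 0)"
      using del_add_corner[OF \<phi>_in[OF res[OF A]]] bij_betw_inv_into_left[OF \<phi> res[OF A]] by simp
    ultimately show "(?\<phi>' (del_corner (?\<psi> A)))((r, s) := ?\<psi> A (r, s) - lower (?\<psi> A) (r, s)) = A"
      by simp
  next
    fix g assume g: "g \<in> rpp D"
    let ?A = "?\<phi>' (del_corner g)"
    have "?A \<in> supported E" using \<phi>'_in del_corner_rpp[OF g] by auto
    then have "?A((r, s) := 0) = ?A" by (auto simp: supported_def)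
    moreover have "\<phi> ?A = del_corner g"
      using bij_betw_inv_into_right[OF \<phi> del_corner_rpp[OF g]] .
    ultimately show "?\<psi> (?A((r, s) := g (r, s) - lower g (r, s))) = g"
      using add_del_corner[OF g] by simp
  qed
next
  fix A k assume A: "A \<in> supported D"
  let ?A' = "A((r, s) := 0)"
  have A': "?A' \<in> supported E" using A by (auto simp: supported_def)
  have f: "\<phi> ?A' \<in> rpp E" using \<phi> A' by (auto simp: bij_betw_def)
  show "trace D (add_corner (\<phi> ?A') (A (r, s))) k = sum A (rect D k)"
  proof (cases "k = int s - int r")
    case True
    show ?thesis
      using trace_add_corner[OF f True, of "A (r, s)"] rect_sum_corner[OF True refl, of A] tr[OF A']
      by simp
  next
    case False
    have "(r, s) \<notin> rect D k"
      unfolding rect_E_other[OF False, symmetric] by (simp add: rect_def)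
    then have "sum ?A' (rect D k) = sum A (rect D k)" by (intro sum.cong) auto
    then show ?thesis
      using trace_add_corner_other[OF False] rect_E_other[OF False] tr[OF A'] by simp
  qed
qed

end

section \<open>Induction over the diagram, corner by corner\<close>

lemma exists_corner:
  assumes "diagram D" "D \<noteq> {}"
  shows "\<exists>r s. corner D r s"
proof -
  \<comment> \<open>A node with maximal coordinate sum has nothing below it or to its right.\<close>
  have fin: "finite ((\<lambda>(i, j). i + j) ` D)" "(\<lambda>(i, j). i + j) ` D \<noteq> {}"
    using assms by (auto simp: diagram_def)
  obtain r s where rs: "(r, s) \<in> D" "r + s = Max ((\<lambda>(i, j). i + j) ` D)"
    using Max_in[OF fin] by auto
  have le: "i + j \<le> r + s" if "(i, j) \<in> D" for i j
    unfolding rs(2) using fin(1) that by (intro Max_ge) auto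
  have "corner D r s"
    using assms(1) rs(1) le by unfold_locales force+
  then show ?thesis by blast
qed

lemma rpp_filling_bijection:
  assumes "diagram D"
  shows "\<exists>\<phi>. bij_betw \<phi> (supported D) (rpp D) \<and>
    (\<forall>A\<in>supported D. \<forall>k. trace D (\<phi> A) k = sum A (rect D k))"
  using assms
proof (induction "card D" arbitrary: D rule: less_induct)
  case less
  show ?case
  proof (cases "D = {}")
    case True
    \<comment> \<open>For the empty shape both sets consist of the zero function alone.\<close>
    have "bij_betw id (supported D) (rpp D)"
      by (simp add: True rpp_def bij_betw_def)
    then show ?thesis by (intro exI[of _ id]) (simp add: True trace_def rect_def)
  next
    case False
    then obtain r s where "corner D r s" using exists_corner less.prems by blast
    then interpret corner D r s .
    have "card E < card D" using corner_in finite_D by (rule card_Diff1_less[rotated])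
    then show ?thesis using less.hyps[OF _ diagram_E] bij_step by blast
  qed
qed

section \<open>Hooks and the total size\<close>

definition hook :: "(nat \<times> nat) set \<Rightarrow> nat \<times> nat \<Rightarrow> (nat \<times> nat) set" where
  "hook D = (\<lambda>(i, j). {(i', j'). (i', j') \<in> D \<and> (i' = i \<and> j' \<ge> j \<or> j' = j \<and> i' > i)})"

text \<open>From a node weakly below and to the right of \<open>u\<close>, follow its diagonal back
  until it first meets the row or the column of \<open>u\<close>; that point is in the hook.
  Conversely, a node of the hook itself spans a rectangle containing \<open>u\<close>.\<close>

lemma node_content_image_hook:
  assumes D: "diagram D" and u: "u \<in> D"
  shows "node_content ` hook D u = {k \<in> node_content ` D. u \<in> rect D k}"
proof -
  obtain i j where ij: "u = (i, j)" by force
  have pos: "0 < i" "0 < j" using diagram_pos[OF D] u ij by auto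
  have "\<exists>w\<in>hook D u. node_content w = node_content (a, b)" if v: "(a, b) \<in> D" "i \<le> a" "j \<le> b" for a b
  \<comment> \<open>Comparing contents with \<open>u = (i, j)\<close> decides whether the diagonal
    meets the arm in row \<open>i\<close> or the leg in column \<open>j\<close>.\<close>
  proof (cases "b + i \<ge> a + j")
    case True
    then have "(i, b + i - a) \<in> hook D u" "node_content (i, b + i - a) = node_content (a, b)"
      using diagramD[OF D v(1), of i "b + i - a"] v pos by (auto simp: hook_def ij node_content_def)
    then show ?thesis by blast
  next
    case False
    then have "(a + j - b, j) \<in> hook D u" "node_content (a + j - b, j) = node_content (a, b)"
      using diagramD[OF D v(1), of "a + j - b" j] v pos by (auto simp: hook_def ij node_content_def)
    then show ?thesis by blast
  qed
  note * = this
  show ?thesis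
  proof (intro set_eqI iffI)
    fix k assume "k \<in> node_content ` hook D u"
    then show "k \<in> {k \<in> node_content ` D. u \<in> rect D k}"
      using u by (force simp: hook_def ij rect_def)
  next
    fix k assume "k \<in> {k \<in> node_content ` D. u \<in> rect D k}"
    then obtain a b where "(a, b) \<in> D" "i \<le> a" "j \<le> b" "k = node_content (a, b)"
      by (auto simp: rect_def ij)
    then show "k \<in> node_content ` hook D u" using *[of a b] by (metis image_eqI)
  qed
qed

lemma inj_on_node_content_hook: "inj_on node_content (hook D u)"
  by (cases u) (auto simp: inj_on_def hook_def node_content_def)

text \<open>Summing the traces over all contents and exchanging sums, \<open>A u\<close> is counted
  once for each content whose rectangle contains \<open>u\<close>. These contents correspond to the
  nodes of the hook, since content is injective on a hook.\<close>

lemma rpp_hook_bijection: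
  assumes D: "diagram D"
  shows "\<exists>\<phi>. bij_betw \<phi> (supported D) (rpp D) \<and>
    (\<forall>A\<in>supported D. sum (\<phi> A) D = (\<Sum>u\<in>D. card (hook D u) * A u))"
proof -
  obtain \<phi> where \<phi>: "bij_betw \<phi> (supported D) (rpp D)"
    and tr: "\<And>A k. A \<in> supported D \<Longrightarrow> trace D (\<phi> A) k = sum A (rect D k)"
    using rpp_filling_bijection[OF D] by blast
  have fin: "finite D" using D by (simp add: diagram_def)
  have "sum (\<phi> A) D = (\<Sum>u\<in>D. card (hook D u) * A u)" if A: "A \<in> supported D" for A
  proof -
    have "sum (\<phi> A) D = (\<Sum>k\<in>node_content ` D. trace D (\<phi> A) k)"
      unfolding trace_def by (rule sum.image_gen[OF fin])
    also have "\<dots> = (\<Sum>k\<in>node_content ` D. \<Sum>u | u \<in> D \<and> u \<in> rect D k. A u)"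
      by (auto simp: tr[OF A] rect_def intro!: sum.cong)
    also have "\<dots> = (\<Sum>u\<in>D. \<Sum>k | k \<in> node_content ` D \<and> u \<in> rect D k. A u)"
      using fin by (intro sum.swap_restrict) auto
    also have "\<dots> = (\<Sum>u\<in>D. card (hook D u) * A u)"
    proof (rule sum.cong[OF refl])
      fix u assume "u \<in> D"
      then have "card {k \<in> node_content ` D. u \<in> rect D k} = card (hook D u)"
        using node_content_image_hook[OF D] card_image[OF inj_on_node_content_hook] by metis
      then show "(\<Sum>k | k \<in> node_content ` D \<and> u \<in> rect D k. A u) = card (hook D u) * A u"
        by simp
    qed
    finally show ?thesis .
  qed
  then show ?thesis using \<phi> by blast
qed


section \<open>Reverse plane partitions and pedestals\<close>

locale labelled_shape =
  fixes lam :: "nat list" and P :: "nat \<times> nat \<Rightarrow> nat"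
  assumes shape: "diagram (young_diagram lam)"
    and P_std: "P \<in> std_tableaux lam"
begin

abbreviation "D \<equiv> young_diagram lam"
abbreviation "n \<equiv> sum_list lam"

definition descent :: "(nat \<times> nat \<Rightarrow> nat) \<Rightarrow> nat \<Rightarrow> bool" where
  "descent Q k \<longleftrightarrow> P (nth_node lam Q (Suc k)) < P (nth_node lam Q k)"

definition precedes :: "(nat \<times> nat \<Rightarrow> nat) \<Rightarrow> nat \<times> nat \<Rightarrow> nat \<times> nat \<Rightarrow> bool" where
  "precedes f x y \<longleftrightarrow> f x < f y \<or> f x = f y \<and> P x < P y"

text \<open>The sum is the total of the increments up to the position of \<open>x\<close> in
  \<open>Q\<close>. The increments are indexed from 1, and \<open>A 1\<close> is the entry at the
  first node.\<close>

definition fill :: "(nat \<times> nat \<Rightarrow> nat) \<times> (nat \<Rightarrow> nat) \<Rightarrow> nat \<times> nat \<Rightarrow> nat" where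
  "fill = (\<lambda>(Q, A) x. if x \<in> D then pedestal lam P Q x + (\<Sum>j=1..Q x. A j) else 0)"

lemma finite_D: "finite D"
  using shape by (simp add: diagram_def)

lemma std_bij: "Q \<in> std_tableaux lam \<Longrightarrow> bij_betw Q D {1..n}"
  by (simp add: std_tableaux_def)

lemma std_range: "Q \<in> std_tableaux lam \<Longrightarrow> x \<in> D \<Longrightarrow> 1 \<le> Q x \<and> Q x \<le> n"
  using std_bij[of Q] bij_betwE by fastforce

lemma card_D: "card D = n"
  using bij_betw_same_card[OF std_bij[OF P_std]] by simp

lemma node_in: "Q \<in> std_tableaux lam \<Longrightarrow> 1 \<le> k \<Longrightarrow> k \<le> n \<Longrightarrow> nth_node lam Q k \<in> D"
  using std_bij[of Q] by (auto simp: nth_node_def bij_betw_def intro!: inv_into_into)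

lemma entry_node: "Q \<in> std_tableaux lam \<Longrightarrow> 1 \<le> k \<Longrightarrow> k \<le> n \<Longrightarrow> Q (nth_node lam Q k) = k"
  using std_bij[of Q] by (auto simp: nth_node_def bij_betw_def intro!: f_inv_into_f)

lemma node_entry: "Q \<in> std_tableaux lam \<Longrightarrow> x \<in> D \<Longrightarrow> nth_node lam Q (Q x) = x"
  using std_bij[of Q] by (auto simp: nth_node_def bij_betw_def)

lemma P_inj: "x \<in> D \<Longrightarrow> y \<in> D \<Longrightarrow> P x = P y \<longleftrightarrow> x = y"
  by (rule inj_on_eq_iff[OF bij_betw_imp_inj_on[OF std_bij[OF P_std]]])

section \<open>Pedestals as counts of descents\<close>

lemma disagreement_iff_descent:
  assumes Q: "Q \<in> std_tableaux lam" and k: "1 \<le> k" "k < n"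
  shows "disagreement_node lam P Q (nth_node lam Q k) \<longleftrightarrow> descent Q k"
proof -
  \<comment> \<open>The index hidden in the definition of a disagreement node is unique, because
    \<open>Q\<close> recovers it from the node.\<close>
  have "k = k'" if "1 \<le> k'" "k' < n" "nth_node lam Q k = nth_node lam Q k'" for k'
    using arg_cong[OF that(3), of Q] entry_node[OF Q, of k] entry_node[OF Q, of k'] that(1,2) k
    by simp
  then have "disagreement_node lam P Q (nth_node lam Q k) \<Longrightarrow> descent Q k"
    unfolding disagreement_node_def descent_def tableau_less_def by auto
  then show ?thesis
    using k unfolding disagreement_node_def descent_def tableau_less_def by auto
qed

lemma pedestal_eq:
  assumes Q: "Q \<in> std_tableaux lam" and x: "x \<in> D"
  shows "pedestal lam P Q x = card {l \<in> {1..<Q x}. descent Q l}"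
proof -
  have "{l. 1 \<le> l \<and> l < Q x \<and> disagreement_node lam P Q (nth_node lam Q l)}
      = {l \<in> {1..<Q x}. descent Q l}"
    using disagreement_iff_descent[OF Q] std_range[OF Q x] by force
  then show ?thesis by (simp add: pedestal_def)
qed

lemma pedestal_first:
  assumes "Q \<in> std_tableaux lam" "1 \<le> n"
  shows "pedestal lam P Q (nth_node lam Q 1) = 0"
  using assms by (simp add: pedestal_eq node_in entry_node)

lemma pedestal_Suc:
  assumes Q: "Q \<in> std_tableaux lam" and k: "1 \<le> k" "k < n"
  shows "pedestal lam P Q (nth_node lam Q (Suc k))
    = pedestal lam P Q (nth_node lam Q k) + of_bool (descent Q k)"
proof -
  have "card {l \<in> {1..<Suc k}. descent Q l} = card {l \<in> {1..<k}. descent Q l} + of_bool (descent Q k)"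
  proof (cases "descent Q k")
    case True
    then have "{l \<in> {1..<Suc k}. descent Q l} = insert k {l \<in> {1..<k}. descent Q l}"
      using k by (auto simp: less_Suc_eq)
    moreover have "card (insert k {l \<in> {1..<k}. descent Q l}) = Suc (card {l \<in> {1..<k}. descent Q l})"
      by (rule card_insert_disjoint) auto
    ultimately show ?thesis using True by (simp only: of_bool_eq add_Suc_right add_0_right One_nat_def)
  next
    case False
    then have "{l \<in> {1..<Suc k}. descent Q l} = {l \<in> {1..<k}. descent Q l}"
      by (auto simp: less_Suc_eq)
    then show ?thesis using False by (simp only: of_bool_eq add_0_right)
  qed
  then show ?thesis using k Q by (simp add: pedestal_eq node_in entry_node)
qed

section \<open>From a tableau with increments to a reverse plane partition, injectively\<close>

lemma fill_node:
  assumes "Q \<in> std_tableaux lam" "1 \<le> k" "k \<le> n"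
  shows "fill (Q, A) (nth_node lam Q k) = pedestal lam P Q (nth_node lam Q k) + (\<Sum>j=1..k. A j)"
  using assms by (simp add: fill_def node_in entry_node)

lemma precedes_trans: "precedes f x y \<Longrightarrow> precedes f y z \<Longrightarrow> precedes f x z"
  by (auto simp: precedes_def)

lemma precedes_total: "x \<in> D \<Longrightarrow> y \<in> D \<Longrightarrow> x \<noteq> y \<Longrightarrow> precedes f x y \<or> precedes f y x"
  using P_inj[of x y] by (auto simp: precedes_def)

lemma precedes_asym: "precedes f x y \<Longrightarrow> \<not> precedes f y x"
  by (auto simp: precedes_def)

text \<open>At a descent the pedestal jumps, so the entry grows strictly. Elsewhere it grows weakly,
  and a tie is resolved correctly because \<open>P\<close> increases.\<close>

lemma fill_precedes_node:
  assumes Q: "Q \<in> std_tableaux lam" and "1 \<le> k"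
  shows "k < k' \<Longrightarrow> k' \<le> n \<Longrightarrow> precedes (fill (Q, A)) (nth_node lam Q k) (nth_node lam Q k')"
proof (induction k')
  case (Suc m)
  have m: "1 \<le> m" "m < n" using Suc.prems assms(2) by auto
  have "nth_node lam Q m \<noteq> nth_node lam Q (Suc m)"
    using entry_node[OF Q, of m] entry_node[OF Q, of "Suc m"] m by auto
  then have "P (nth_node lam Q m) \<noteq> P (nth_node lam Q (Suc m))"
    using P_inj node_in[OF Q] m by simp
  then have step: "precedes (fill (Q, A)) (nth_node lam Q m) (nth_node lam Q (Suc m))"
    using m pedestal_Suc[OF Q m] fill_node[OF Q, of m A] fill_node[OF Q, of "Suc m" A]
    by (auto simp: precedes_def descent_def)
  show ?case
  proof (cases "k = m")
    case False
    then show ?thesis using Suc step precedes_trans[of _ _ "nth_node lam Q m"] by simp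
  qed (use step in simp)
qed simp

lemma fill_precedes_iff:
  assumes Q: "Q \<in> std_tableaux lam" and x: "x \<in> D" and y: "y \<in> D"
  shows "precedes (fill (Q, A)) x y \<longleftrightarrow> Q x < Q y"
proof -
  have *: "precedes (fill (Q, A)) u v" if "u \<in> D" "v \<in> D" "Q u < Q v" for u v
    using fill_precedes_node[OF Q, of "Q u" "Q v" A] that std_range[OF Q] node_entry[OF Q] by metis
  show ?thesis
  proof
    assume pre: "precedes (fill (Q, A)) x y"
    then have "x \<noteq> y" by (auto simp: precedes_def)
    then have "Q x \<noteq> Q y" using node_entry[OF Q] x y by metis
    then show "Q x < Q y" using *[OF y x] precedes_asym[OF pre] by linarith
  qed (rule *[OF x y])
qed

lemma fill_rpp:
  assumes Q: "Q \<in> std_tableaux lam"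
  shows "fill (Q, A) \<in> rpp D"
proof -
  \<comment> \<open>The premise on \<open>x\<close> is conditional because an upper or left
    neighbour may lie in row 0 or column 0, where the filling is 0.\<close>
  have mono: "fill (Q, A) x \<le> fill (Q, A) y" if "x \<in> D \<Longrightarrow> Q x < Q y" "y \<in> D" for x y
  proof (cases "x \<in> D")
    case True
    then show ?thesis
      using fill_precedes_iff[OF Q True that(2), of A] that(1) by (auto simp: precedes_def)
  qed (simp add: fill_def)
  have "fill (Q, A) (i, j) \<le> fill (Q, A) (Suc i, j)" if "(Suc i, j) \<in> D" for i j
    using Q that by (intro mono) (auto simp: std_tableaux_def)
  moreover have "fill (Q, A) (i, j) \<le> fill (Q, A) (i, Suc j)" if "(i, Suc j) \<in> D" for i j
    using Q that by (intro mono) (auto simp: std_tableaux_def)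
  moreover have "fill (Q, A) \<in> supported D" by (simp add: supported_def fill_def)
  ultimately show ?thesis unfolding rpp_def by blast
qed

text \<open>The right side depends on the filling alone, so \<open>Q\<close> can be read off from
  \<open>fill (Q, A)\<close>.\<close>

lemma entry_eq_card:
  assumes Q: "Q \<in> std_tableaux lam" and x: "x \<in> D"
  shows "Q x = card {y \<in> D. \<not> precedes (fill (Q, A)) x y}"
proof -
  have "bij_betw Q {y \<in> D. \<not> precedes (fill (Q, A)) x y} {1..Q x}"
  proof (rule bij_betw_subset[OF std_bij[OF Q], of _ "{1..Q x}"])
    show "Q ` {y \<in> D. \<not> precedes (fill (Q, A)) x y} = {1..Q x}"
    proof (intro set_eqI iffI)
      fix k assume k: "k \<in> {1..Q x}"
      then have "1 \<le> k" "k \<le> n" using std_range[OF Q x] by auto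
      then have "nth_node lam Q k \<in> D" "Q (nth_node lam Q k) = k"
        using node_in[OF Q] entry_node[OF Q] by auto
      then show "k \<in> Q ` {y \<in> D. \<not> precedes (fill (Q, A)) x y}"
        using k fill_precedes_iff[OF Q x] by (intro image_eqI[of _ _ "nth_node lam Q k"]) auto
    qed (use fill_precedes_iff[OF Q x] std_range[OF Q] in auto)
  qed auto
  then show ?thesis using bij_betw_same_card by fastforce
qed

text \<open>The tableau is recovered by counting predecessors. Removing its pedestal leaves the
  partial sums of \<open>A\<close>, whose differences give \<open>A\<close>.\<close>

lemma inj_on_fill: "inj_on fill (std_tableaux lam \<times> supported {1..n})"
proof (rule inj_onI, clarify)
  fix Q A Q' A'
  assume Q: "Q \<in> std_tableaux lam" and Q': "Q' \<in> std_tableaux lam"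
    and A: "A \<in> supported {1..n}" and A': "A' \<in> supported {1..n}"
    and eq: "fill (Q, A) = fill (Q', A')"
  have "Q x = Q' x" for x
  proof (cases "x \<in> D")
    case True
    show ?thesis using entry_eq_card[OF Q True, of A] entry_eq_card[OF Q' True, of A'] eq by simp
  next
    case False
    moreover have "Q \<in> extensional D" "Q' \<in> extensional D"
      using Q Q' by (simp_all add: std_tableaux_def)
    ultimately show ?thesis by (metis extensional_arb)
  qed
  then have QQ: "Q = Q'" by blast
  have sums: "(\<Sum>j=1..k. A j) = (\<Sum>j=1..k. A' j)" if "k \<le> n" for k
  proof (cases "k = 0")
    case False
    then show ?thesis
      using fill_node[OF Q, of k A] fill_node[OF Q, of k A'] eq QQ that by simp
  qed simp
  have "A k = A' k" for k
  proof (cases "k \<in> {1..n}")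
    case True
    then obtain m where "k = Suc m" by (cases k) auto
    then show ?thesis using sums[of m] sums[of k] True by simp
  qed (use A A' in \<open>auto simp: supported_def\<close>)
  with QQ show "Q = Q' \<and> A = A'" by blast
qed

section \<open>Standardization, and surjectivity of the filling map\<close>

text \<open>
  The number of nodes up to and including \<open>x\<close> in the order \<open>precedes f\<close>, as this order is total.
\<close>

definition standardization :: "(nat \<times> nat \<Rightarrow> nat) \<Rightarrow> nat \<times> nat \<Rightarrow> nat" where
  "standardization f = restrict (\<lambda>x. card {y \<in> D. \<not> precedes f x y}) D"

lemma standardization_less:
  assumes "x \<in> D" "y \<in> D" "precedes f x y"
  shows "standardization f x < standardization f y"
proof -
  have "y \<in> {z \<in> D. \<not> precedes f y z}" "y \<notin> {z \<in> D. \<not> precedes f x z}"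
    using assms by (auto simp: precedes_def)
  moreover have "{z \<in> D. \<not> precedes f x z} \<subseteq> {z \<in> D. \<not> precedes f y z}"
    using precedes_trans[OF assms(3)] by blast
  ultimately have "{z \<in> D. \<not> precedes f x z} \<subset> {z \<in> D. \<not> precedes f y z}" by blast
  then show ?thesis using assms(1,2) finite_D
    by (auto simp: standardization_def intro!: psubset_card_mono)
qed

lemma standardization_bij: "bij_betw (standardization f) D {1..n}"
proof -
  have inj: "inj_on (standardization f) D"
    using standardization_less precedes_total by (metis inj_onI less_irrefl)
  have "standardization f x \<in> {1..n}" if x: "x \<in> D" for x
  proof -
    have "x \<in> {z \<in> D. \<not> precedes f x z}" using x by (auto simp: precedes_def)
    moreover have "finite {z \<in> D. \<not> precedes f x z}" using finite_D by simp
    ultimately have "0 < card {z \<in> D. \<not> precedes f x z}" unfolding card_gt_0_iff by blast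
    moreover have "card {z \<in> D. \<not> precedes f x z} \<le> card D"
      using finite_D by (intro card_mono) auto
    ultimately show ?thesis using x card_D by (simp add: standardization_def)
  qed
  then have "standardization f ` D \<subseteq> {1..n}" by blast
  then have "standardization f ` D = {1..n}"
    using card_image[OF inj] card_D by (intro card_subset_eq) auto
  then show ?thesis using inj by (simp add: bij_betw_def)
qed

lemma rpp_mono_col:
  assumes "f \<in> rpp D" "(i', j) \<in> D" "0 < i" "i \<le> i'"
  shows "f (i, j) \<le> f (i', j)"
  using assms(4,2)
proof (induction rule: dec_induct)
  case (step m)
  have "(m, j) \<in> D"
    using diagramD[OF shape step.prems, of m j] diagram_pos[OF shape step.prems] step assms(3) by auto
  then show ?case using step assms(1) by (fastforce simp: rpp_def)
qed simp

lemma rpp_mono_row: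
  assumes "f \<in> rpp D" "(i, j') \<in> D" "0 < j" "j \<le> j'"
  shows "f (i, j) \<le> f (i, j')"
  using assms(4,2)
proof (induction rule: dec_induct)
  case (step m)
  have "(i, m) \<in> D"
    using diagramD[OF shape step.prems, of i m] diagram_pos[OF shape step.prems] step assms(3) by auto
  then show ?case using step assms(1) by (fastforce simp: rpp_def)
qed simp

text \<open>Along rows and columns \<open>f\<close> grows weakly and \<open>P\<close> strictly, so
  breaking ties by \<open>P\<close> respects the shape.\<close>

lemma standardization_std:
  assumes f: "f \<in> rpp D"
  shows "standardization f \<in> std_tableaux lam"
proof -
  have "standardization f (i, j) < standardization f (i', j)"
    if "(i, j) \<in> D" "(i', j) \<in> D" "i < i'" for i i' j
    using that P_std rpp_mono_col[OF f that(2), of i] diagram_pos[OF shape that(1)]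
    by (intro standardization_less) (auto simp: precedes_def std_tableaux_def le_less)
  moreover have "standardization f (i, j) < standardization f (i, j')"
    if "(i, j) \<in> D" "(i, j') \<in> D" "j < j'" for i j j'
    using that P_std rpp_mono_row[OF f that(2), of j] diagram_pos[OF shape that(1)]
    by (intro standardization_less) (auto simp: precedes_def std_tableaux_def le_less)
  ultimately show ?thesis
    using standardization_bij by (auto simp: std_tableaux_def standardization_def)
qed

text \<open>Consecutive nodes with equal entries are ordered by \<open>P\<close>, so a descent
  forces a strict increase. This keeps the increments in \<open>fill_surj\<close>
  nonnegative.\<close>

lemma standardization_step:
  assumes f: "f \<in> rpp D" and k: "1 \<le> k" "k < n"
  defines "Q \<equiv> standardization f"
  shows "f (nth_node lam Q k) + of_bool (descent Q k) \<le> f (nth_node lam Q (Suc k))"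
proof -
  have Q: "Q \<in> std_tableaux lam" unfolding Q_def by (rule standardization_std[OF f])
  let ?x = "nth_node lam Q k" and ?y = "nth_node lam Q (Suc k)"
  have xy: "?x \<in> D" "?y \<in> D" "Q ?x = k" "Q ?y = Suc k"
    using node_in[OF Q] entry_node[OF Q] k by auto
  have "\<not> precedes f ?y ?x"
    using standardization_less[OF xy(2,1), of f] xy(3,4) by (auto simp: Q_def)
  then have "precedes f ?x ?y" using precedes_total[of ?x ?y f] xy by fastforce
  then show ?thesis by (auto simp: precedes_def descent_def)
qed

lemma fill_surj:
  assumes f: "f \<in> rpp D"
  shows "f \<in> fill ` (std_tableaux lam \<times> supported {1..n})"
proof -
  define Q where "Q = standardization f"
  have Q: "Q \<in> std_tableaux lam" unfolding Q_def by (rule standardization_std[OF f])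
  define b where "b k = f (nth_node lam Q k)" for k
  \<comment> \<open>This inverts \<open>fill\<close>: the rise of the sorted entries minus the jump
    of the pedestal, which starts at 0. By \<open>standardization_step\<close> no subtraction is
    truncated.\<close>
  define A where "A k = (if k \<in> {1..n} then
     if k = 1 then b 1 else b k - b (k - 1) - of_bool (descent Q (k - 1)) else 0)" for k
  have A: "A \<in> supported {1..n}" by (auto simp: supported_def A_def)
  have b: "pedestal lam P Q (nth_node lam Q k) + (\<Sum>j=1..k. A j) = b k" if "1 \<le> k" "k \<le> n" for k
    using that
  proof (induction rule: dec_induct)
    case base
    then show ?case using pedestal_first[OF Q] by (simp add: A_def)
  next
    case (step m)
    have "b m + of_bool (descent Q m) \<le> b (Suc m)"
      using standardization_step[OF f, of m] step by (simp add: b_def Q_def)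
    moreover have "A (Suc m) = b (Suc m) - b m - of_bool (descent Q m)"
      using step by (simp add: A_def)
    ultimately show ?case using step pedestal_Suc[OF Q, of m] by simp
  qed
  have "fill (Q, A) = f"
  proof
    fix x
    show "fill (Q, A) x = f x"
    proof (cases "x \<in> D")
      case True
      then show ?thesis
        using b[of "Q x"] std_range[OF Q True] node_entry[OF Q True] by (simp add: fill_def b_def)
    next
      case False
      then show ?thesis using rpp_supported[OF f] by (simp add: fill_def)
    qed
  qed
  then show ?thesis using Q A by (intro image_eqI[of _ _ "(Q, A)"]) auto
qed

lemma fill_bij: "bij_betw fill (std_tableaux lam \<times> supported {1..n}) (rpp D)"
  unfolding bij_betw_def using inj_on_fill fill_rpp fill_surj by auto

text \<open>The increment \<open>A j\<close> contributes to every node whose entry in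
  \<open>Q\<close> is at least \<open>j\<close>, and there are \<open>n + 1 - j\<close> of
  these.\<close>

lemma fill_size:
  assumes Q: "Q \<in> std_tableaux lam"
  shows "sum (fill (Q, A)) D = pedestal_size lam P Q + (\<Sum>j=1..n. (n + 1 - j) * A j)"
proof -
  have "(\<Sum>x\<in>D. \<Sum>j=1..Q x. A j) = (\<Sum>k=1..n. \<Sum>j=1..k. A j)"
    by (rule sum.reindex_bij_betw[OF std_bij[OF Q]])
  also have "\<dots> = (\<Sum>k=1..n. \<Sum>j | j \<in> {1..n} \<and> j \<le> k. A j)"
    by (intro sum.cong) auto
  also have "\<dots> = (\<Sum>j=1..n. \<Sum>k | k \<in> {1..n} \<and> j \<le> k. A j)"
    by (rule sum.swap_restrict) auto
  also have "\<dots> = (\<Sum>j=1..n. (n + 1 - j) * A j)"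
  proof (rule sum.cong[OF refl])
    fix j assume "j \<in> {1..n}"
    then have "{k \<in> {1..n}. j \<le> k} = {j..n}" by auto
    then show "(\<Sum>k | k \<in> {1..n} \<and> j \<le> k. A j) = (n + 1 - j) * A j" by simp
  qed
  finally show ?thesis by (simp add: fill_def pedestal_size_def sum.distrib)
qed

end


section \<open>Generating functions\<close>

definition enumerator :: "('a \<Rightarrow> nat) \<Rightarrow> 'a set \<Rightarrow> rat fps" where
  "enumerator w S = Abs_fps (\<lambda>N. of_nat (card {x \<in> S. w x = N}))"

lemma enumerator_bij:
  assumes "bij_betw \<phi> S T" "\<And>x. x \<in> S \<Longrightarrow> w' (\<phi> x) = w x"
  shows "enumerator w S = enumerator w' T"
proof -
  have "bij_betw \<phi> {x \<in> S. w x = N} {y \<in> T. w' y = N}" for N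
    using assms by (intro bij_betw_subset[OF assms(1)]) (auto simp: bij_betw_def)
  then have "card {x \<in> S. w x = N} = card {y \<in> T. w' y = N}" for N
    by (rule bij_betw_same_card)
  then show ?thesis by (simp add: enumerator_def)
qed

text \<open>Each \<open>i\<close> shifts the levels of \<open>S\<close> by \<open>v i\<close>.
  Finite levels are assumed since \<open>card\<close> is 0 on infinite sets.\<close>

lemma enumerator_Times:
  assumes "finite I" "\<And>N. finite {x \<in> S. w x = N}"
  shows "enumerator (\<lambda>(i, x). v i + w x) (I \<times> S) = (\<Sum>i\<in>I. fps_X ^ v i) * enumerator w S"
proof (rule fps_ext)
  fix N
  have "{p \<in> I \<times> S. (case p of (i, x) \<Rightarrow> v i + w x) = N}
      = Sigma I (\<lambda>i. {x \<in> S. v i \<le> N \<and> w x = N - v i})"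
    by auto
  moreover have "card {x \<in> S. v i \<le> N \<and> w x = N - v i}
      = (if v i \<le> N then card {x \<in> S. w x = N - v i} else 0)" for i
    by simp
  moreover have "finite {x \<in> S. v i \<le> N \<and> w x = N - v i}" for i
    by (rule finite_subset[OF _ assms(2)[of "N - v i"]]) auto
  ultimately have "card {p \<in> I \<times> S. (case p of (i, x) \<Rightarrow> v i + w x) = N}
      = (\<Sum>i\<in>I. if v i \<le> N then card {x \<in> S. w x = N - v i} else 0)"
    using assms(1) by (simp add: card_SigmaI)
  then show "fps_nth (enumerator (\<lambda>(i, x). v i + w x) (I \<times> S)) N
      = fps_nth ((\<Sum>i\<in>I. fps_X ^ v i) * enumerator w S) N"
    by (simp add: enumerator_def sum_distrib_right fps_sum_nth fps_X_power_mult_nth)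
       (auto intro!: sum.cong)
qed

lemma finite_level:
  fixes h :: "'a \<Rightarrow> nat"
  assumes "finite S" "\<And>u. u \<in> S \<Longrightarrow> 0 < h u"
  shows "finite {A \<in> supported S. (\<Sum>u\<in>S. h u * A u) = N}"
proof (rule finite_subset)
  show "finite {A. \<forall>x. (x \<in> S \<longrightarrow> A x \<in> {..N}) \<and> (x \<notin> S \<longrightarrow> A x = 0)}"
    using assms(1) by (intro finite_set_of_finite_funs) auto
  have "A x \<le> (\<Sum>u\<in>S. h u * A u)" if "x \<in> S" for A x
  proof -
    have "A x \<le> h x * A x" using assms(2)[OF that] by simp
    also have "\<dots> \<le> (\<Sum>u\<in>S. h u * A u)" using assms(1) that by (intro member_le_sum) auto
    finally show ?thesis .
  qed
  then show "{A \<in> supported S. (\<Sum>u\<in>S. h u * A u) = N}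
      \<subseteq> {A. \<forall>x. (x \<in> S \<longrightarrow> A x \<in> {..N}) \<and> (x \<notin> S \<longrightarrow> A x = 0)}"
    by (auto simp: supported_def)
qed

text \<open>Lowering a positive value at \<open>c\<close> by one lowers the weight by
  \<open>h c\<close>, so the factor \<open>1 - fps_X ^ h c\<close> cancels all fillings that are
  nonzero at \<open>c\<close>. The others are the fillings of \<open>S\<close>.\<close>

lemma enumerator_supported_insert:
  fixes h :: "'a \<Rightarrow> nat"
  assumes S: "finite S" "c \<notin> S" and h: "\<And>u. u \<in> insert c S \<Longrightarrow> 0 < h u"
  shows "enumerator (\<lambda>A. \<Sum>u\<in>insert c S. h u * A u) (supported (insert c S)) * (1 - fps_X ^ h c)
    = enumerator (\<lambda>A. \<Sum>u\<in>S. h u * A u) (supported S)"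
proof (rule fps_ext)
  fix N
  let ?W = "\<lambda>A. \<Sum>u\<in>insert c S. h u * A u"
  let ?L = "\<lambda>N. {A \<in> supported (insert c S). ?W A = N}"
  let ?M = "{A \<in> supported S. (\<Sum>u\<in>S. h u * A u) = N}"
  let ?up = "\<lambda>A. A(c := Suc (A c))"
  have W: "?W A = h c * A c + (\<Sum>u\<in>S. h u * A u)" for A
    using S by simp
  have S_cong: "(\<Sum>u\<in>S. h u * (A(c := a)) u) = (\<Sum>u\<in>S. h u * A u)" for A a
    using S by (intro sum.cong) auto
  have fin: "finite (?L N)" for N
    using S h by (intro finite_level) auto
  have zero: "{A \<in> ?L N. A c = 0} = ?M"
  proof (intro set_eqI iffI)
    fix A assume "A \<in> ?M"
    moreover then have "A c = 0" using S by (auto simp: supported_def)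
    ultimately show "A \<in> {A \<in> ?L N. A c = 0}" by (auto simp: W supported_def)
  next
    fix A assume "A \<in> {A \<in> ?L N. A c = 0}"
    then show "A \<in> ?M" by (clarsimp simp: W supported_def) metis
  qed
  have pos: "{A \<in> ?L N. A c \<noteq> 0} = (if h c \<le> N then ?up ` ?L (N - h c) else {})"
  proof (intro set_eqI iffI)
    fix A assume A: "A \<in> {A \<in> ?L N. A c \<noteq> 0}"
    then obtain a where a: "A c = Suc a" using not0_implies_Suc[of "A c"] by auto
    have le: "h c \<le> N" using A a by (auto simp: W)
    have "A(c := a) \<in> ?L (N - h c)" using A a by (auto simp: W S_cong[unfolded fun_upd_def] supported_def)
    moreover have "A = ?up (A(c := a))" using a by auto
    ultimately have "A \<in> ?up ` ?L (N - h c)" by (intro image_eqI[of A ?up "A(c := a)"])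
    then show "A \<in> (if h c \<le> N then ?up ` ?L (N - h c) else {})" using le by simp
  next
    fix A assume "A \<in> (if h c \<le> N then ?up ` ?L (N - h c) else {})"
    then obtain B where "h c \<le> N" "B \<in> ?L (N - h c)" "A = ?up B" by (auto split: if_splits)
    then show "A \<in> {A \<in> ?L N. A c \<noteq> 0}"
      using S_cong[of B] by (auto simp: W supported_def)
  qed
  have inj: "inj_on ?up X" for X
    by (rule inj_on_inverseI[where g = "\<lambda>A. A(c := A c - 1)"]) simp
  have "?L N = {A \<in> ?L N. A c = 0} \<union> {A \<in> ?L N. A c \<noteq> 0}" by blast
  then have "card (?L N) = card {A \<in> ?L N. A c = 0} + card {A \<in> ?L N. A c \<noteq> 0}"
    using fin by (metis (no_types, lifting) card_Un_disjoint disjoint_iff finite_Un mem_Collect_eq)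
  also have "\<dots> = card ?M + (if h c \<le> N then card (?L (N - h c)) else 0)"
    unfolding zero pos using card_image[OF inj] by simp
  finally show "fps_nth (enumerator ?W (supported (insert c S)) * (1 - fps_X ^ h c)) N
      = fps_nth (enumerator (\<lambda>A. \<Sum>u\<in>S. h u * A u) (supported S)) N"
    by (simp add: enumerator_def right_diff_distrib fps_X_power_mult_right_nth)
qed

lemma enumerator_supported:
  fixes h :: "'a \<Rightarrow> nat"
  assumes "finite S" "\<And>u. u \<in> S \<Longrightarrow> 0 < h u"
  shows "enumerator (\<lambda>A. \<Sum>u\<in>S. h u * A u) (supported S) * (\<Prod>u\<in>S. 1 - fps_X ^ h u) = 1"
  using assms
proof (induction S rule: finite_induct)
  case empty
  have "supported {} = {\<lambda>_ :: 'a. 0}" by (auto simp: supported_def)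
  then show ?case by (auto simp: enumerator_def fps_eq_iff)
next
  case (insert c S)
  then show ?case
    using enumerator_supported_insert[of S c h] by (simp add: mult.assoc[symmetric])
qed

section \<open>Application to the Young diagram of a partition\<close>

lemma diagram_young:
  assumes "is_partition n lam"
  shows "diagram (young_diagram lam)"
proof -
  have mono: "lam ! (i - 1) \<le> lam ! (i' - 1)" if "1 \<le> i'" "i' \<le> i" "i \<le> length lam" for i i'
  proof (cases "i' = i")
    case False
    then show ?thesis
      using assms that by (auto simp: is_partition_def intro!: sorted_wrt_nth_less[of "(\<ge>)" lam])
  qed simp
  have "lam ! (i - 1) \<le> sum_list lam" if "1 \<le> i" "i \<le> length lam" for i
    using that by (intro elem_le_sum_list) auto
  then have "young_diagram lam \<subseteq> {1..length lam} \<times> {1..sum_list lam}"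
    unfolding young_diagram_def using order_trans by fastforce
  then have "finite (young_diagram lam)" by (rule finite_subset) simp
  moreover have "(i', j') \<in> young_diagram lam"
    if "(i, j) \<in> young_diagram lam" "1 \<le> i'" "i' \<le> i" "1 \<le> j'" "j' \<le> j" for i j i' j'
    using that mono[of i' i] by (auto simp: young_diagram_def)
  ultimately show ?thesis
    unfolding diagram_def by (auto simp: young_diagram_def)
qed

lemma hook_length_eq: "hook_length lam u = card (hook (young_diagram lam) u)"
  by (cases u) (simp add: hook_length_def hook_def)

lemma hook_length_pos:
  assumes "finite (young_diagram lam)" "u \<in> young_diagram lam"
  shows "0 < hook_length lam u"
proof -
  have "u \<in> hook (young_diagram lam) u" using assms(2) by (cases u) (simp add: hook_def)
  moreover have "finite (hook (young_diagram lam) u)"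
    using assms(1) by (rule rev_finite_subset) (auto simp: hook_def)
  ultimately show ?thesis by (auto simp: hook_length_eq card_gt_0_iff)
qed

lemma finite_std_tableaux:
  assumes "finite (young_diagram lam)"
  shows "finite (std_tableaux lam)"
proof (rule finite_subset)
  show "std_tableaux lam \<subseteq> (\<Pi>\<^sub>E x\<in>young_diagram lam. {1..sum_list lam})"
    by (auto simp: std_tableaux_def PiE_def bij_betw_def)
qed (use assms in \<open>simp add: finite_PiE\<close>)

theorem mainTheorem3:
  fixes n :: nat and lam :: "nat list" and P :: "nat \<times> nat \<Rightarrow> nat"
  assumes "n \<ge> 1"
    and "is_partition n lam"
    and "P \<in> std_tableaux lam"
  shows "(1 :: rat fps) / (\<Prod>a\<in>young_diagram lam. 1 - fps_X ^ hook_length lam a) =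
         fps_of_poly (pedestal_poly lam P) / (\<Prod>k=1..n. 1 - fps_X ^ k)"
proof -
  let ?D = "young_diagram lam"
  let ?H = "\<Prod>a\<in>?D. 1 - fps_X ^ hook_length lam a :: rat fps"
  let ?K = "\<Prod>k=1..n. 1 - fps_X ^ k :: rat fps"
  let ?F = "enumerator (\<lambda>f. sum f ?D) (rpp ?D)"
  have n: "sum_list lam = n" using assms(2) by (simp add: is_partition_def)
  have D: "diagram ?D" by (rule diagram_young[OF assms(2)])
  then have fin: "finite ?D" by (simp add: diagram_def)
  interpret labelled_shape lam P using D assms(3) by unfold_locales
  obtain \<phi> where "bij_betw \<phi> (supported ?D) (rpp ?D)"
    "\<And>A. A \<in> supported ?D \<Longrightarrow> sum (\<phi> A) ?D = (\<Sum>u\<in>?D. hook_length lam u * A u)"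
    using rpp_hook_bijection[OF D] unfolding hook_length_eq by blast
  then have "enumerator (\<lambda>A. \<Sum>u\<in>?D. hook_length lam u * A u) (supported ?D) = ?F"
    by (rule enumerator_bij[where w' = "\<lambda>f. sum f ?D"])
  then have FH: "?F * ?H = 1"
    using enumerator_supported[OF fin, of "hook_length lam"] hook_length_pos[OF fin] by simp
  let ?w = "\<lambda>A. \<Sum>j\<in>{1..n}. (n + 1 - j) * A j"
  let ?p = "\<lambda>(Q, A). pedestal_size lam P Q + ?w A"
  have "?F = enumerator ?p (std_tableaux lam \<times> supported {1..n})"
    using fill_bij fill_size unfolding n by (intro enumerator_bij[symmetric]) auto
  also have "\<dots> = (\<Sum>Q\<in>std_tableaux lam. fps_X ^ pedestal_size lam P Q) * enumerator ?w (supported {1..n})"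
    by (intro enumerator_Times finite_std_tableaux fin finite_level) auto
  also have "(\<Sum>Q\<in>std_tableaux lam. fps_X ^ pedestal_size lam P Q)
      = (fps_of_poly (pedestal_poly lam P) :: rat fps)"
    by (simp add: pedestal_poly_def fps_of_poly_sum fps_of_poly_monom)
  finally have F: "?F = fps_of_poly (pedestal_poly lam P) * enumerator ?w (supported {1..n})" .
  \<comment> \<open>The increments carry the weights \<open>n, ..., 1\<close>, so the product is
    read in reverse order.\<close>
  have rev: "?K = (\<Prod>j\<in>{1..n}. 1 - fps_X ^ (n + 1 - j))"
    by (subst prod.atLeastAtMost_rev) (simp add: add.commute)
  have GK: "enumerator ?w (supported {1..n}) * ?K = 1"
    unfolding rev by (rule enumerator_supported) auto
  have FK: "?F * ?K = fps_of_poly (pedestal_poly lam P)"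
    by (simp only: F GK mult.assoc mult_1_right)
  \<comment> \<open>Division of power series cancels only nonzero factors; both products divide a
    unit or are units themselves, by \<open>FH\<close> and \<open>GK\<close>.\<close>
  have nz: "?H \<noteq> 0" "?K \<noteq> 0" using FH GK by (metis mult_zero_right zero_neq_one)+
  have "1 / ?H = ?F" using FH nz by (metis nonzero_mult_div_cancel_right)
  also have "?F = fps_of_poly (pedestal_poly lam P) / ?K"
    using FK nz by (metis nonzero_mult_div_cancel_right)
  finally show ?thesis .
qed

end
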